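(* Let $\theta\in(0,1)$. Then for every iteration index $k\ge1$ the error $\boldsymbol{h}^k$ of the time discrete (implicit Euler) Dirichlet--Neumann waveform relaxation iteration satisfies $$\|\boldsymbol{h}^k\|_{l^2}\le\min_{r>0}\,e^{rT}\max_{\omega\in[-\pi,\pi]}\left|\hat\rho\left(\frac{1-e^{-r\Delta t-i\omega}}{\Delta t}\right)^k\right|\,\|\boldsymbol{h}^0\|_{l^2},$$ where $$\hat\rho(s)=1-\theta-\theta\sqrt{\frac{\alpha_1\lambda_1}{\alpha_2\lambda_2}}\coth\left(\sqrt{\frac{\alpha_1 s}{\lambda_1}}\,a\right)\tanh\left(\sqrt{\frac{\alpha_2 s}{\lambda_2}}\,b\right),\qquad s\in\mathbb{C}.$$
   Context: Let $a,b,T>0$, $\alpha_j,\lambda_j>0$ ($j=1,2$), $N\in\mathbb{N}$, $N\geq 1$, $\Delta t=T/N$. The time discrete DNWR iteration discretizes in time by implicit Euler (space is kept continuous). By linearity, its error is described by the iteration with all sources, initial data and outer boundary data equal to zero: given an arbitrary initial interface error $\boldsymbol{h}^0=(h^{1,0},\dots,h^{N,0})\in\mathbb{R}^N$, for $k=0,1,2,\dots$ and $n=0,\dots,N-1$, with $u_1^{0,k+1}=0$ and $u_2^{0,k+1}=0$, solve the two-point boundary value problems $$\frac{\alpha_1}{\Delta t}\left(u_1^{n+1,k+1}-u_1^{n,k+1}\right)-\lambda_1\partial_{xx}u_1^{n+1,k+1}=0\ \text{in }(-a,0),\quad u_1^{n+1,k+1}(-a)=0,\quad u_1^{n+1,k+1}(0)=h^{n+1,k},$$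 $$\frac{\alpha_2}{\Delta t}\left(u_2^{n+1,k+1}-u_2^{n,k+1}\right)-\lambda_2\partial_{xx}u_2^{n+1,k+1}=0\ \text{in }(0,b),\quad -\lambda_2\partial_xu_2^{n+1,k+1}(0)=-\lambda_1\partial_xu_1^{n+1,k+1}(0),\quad u_2^{n+1,k+1}(b)=0,$$ and update $h^{n+1,k+1}=(1-\theta)h^{n+1,k}+\theta u_2^{n+1,k+1}(0)$, where $\theta\in(0,1)$ is the relaxation parameter. Write $\boldsymbol{h}^k=(h^{1,k},\dots,h^{N,k})$ and $\|\boldsymbol{h}^k\|_{l^2}^2=\sum_{n=1}^N(h^{n,k})^2$. In $\hat\rho$ the square roots of complex arguments are principal (all square-root branches give the same value). The symbol $\min_{r>0}$ is to be read as an infimum when not attained. *)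

theory Defs
  imports "HOL-Analysis.Analysis"
begin

text \<open>
  One implicit Euler step of \<open>\<alpha> \<partial>\<^sub>t u = lam \<partial>\<^sub>x\<^sub>x u\<close> on \<open>[l, r]\<close> in the classical sense: \<open>v\<close> and \<open>u\<close> are
  the old and the new time level, and \<open>u'\<close> is the spatial derivative of \<open>u\<close>. Since \<open>u'\<close> is required
  on the closed interval, its values at \<open>l\<close> and \<open>r\<close> are the one-sided derivatives, which are the
  boundary fluxes used in the transmission condition.
\<close>

definition heat_euler_step ::
    "real \<Rightarrow> real \<Rightarrow> real \<Rightarrow> real \<Rightarrow> real \<Rightarrow> (real \<Rightarrow> real) \<Rightarrow> (real \<Rightarrow> real) \<Rightarrow> (real \<Rightarrow> real) \<Rightarrow> bool" where
  "heat_euler_step \<alpha> lam \<Delta>t l r v u u' \<longleftrightarrow>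
     (\<forall>x\<in>{l..r}. (u has_real_derivative u' x) (at x within {l..r})) \<and>
     (\<forall>x\<in>{l<..<r}. \<exists>u''. (u' has_real_derivative u'') (at x) \<and>
        \<alpha> / \<Delta>t * (u x - v x) - lam * u'' = 0)"

text \<open>
  One step \<open>g \<mapsto> h\<close> of the error iteration on interface values. Vectors of length \<open>N\<close> are functions
  on \<open>nat\<close> of which only the entries with index in \<open>{1..N}\<close> matter. The first argument of \<open>u1\<close> and
  \<open>u2\<close> is the time level.
\<close>

definition dnwr_error_step ::
    "real \<Rightarrow> real \<Rightarrow> real \<Rightarrow> real \<Rightarrow> real \<Rightarrow> real \<Rightarrow> real \<Rightarrow> real \<Rightarrow> nat \<Rightarrow>
     (nat \<Rightarrow> real) \<Rightarrow> (nat \<Rightarrow> real) \<Rightarrow> bool" where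
  "dnwr_error_step a b \<alpha>1 \<alpha>2 lam1 lam2 \<theta> \<Delta>t N g h \<longleftrightarrow>
     (\<exists>u1 u1' u2 u2' :: nat \<Rightarrow> real \<Rightarrow> real.
        (\<forall>x\<in>{-a..0}. u1 0 x = 0) \<and>
        (\<forall>x\<in>{0..b}. u2 0 x = 0) \<and>
        (\<forall>n<N.
           heat_euler_step \<alpha>1 lam1 \<Delta>t (-a) 0 (u1 n) (u1 (Suc n)) (u1' (Suc n)) \<and>
           u1 (Suc n) (-a) = 0 \<and>
           u1 (Suc n) 0 = g (Suc n) \<and>
           heat_euler_step \<alpha>2 lam2 \<Delta>t 0 b (u2 n) (u2 (Suc n)) (u2' (Suc n)) \<and>
           - lam2 * u2' (Suc n) 0 = - lam1 * u1' (Suc n) 0 \<and>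
           u2 (Suc n) b = 0 \<and>
           h (Suc n) = (1 - \<theta>) * g (Suc n) + \<theta> * u2 (Suc n) 0))"

definition coth :: "complex \<Rightarrow> complex" where
  "coth z = cosh z / sinh z"

definition rho_hat ::
    "real \<Rightarrow> real \<Rightarrow> real \<Rightarrow> real \<Rightarrow> real \<Rightarrow> real \<Rightarrow> real \<Rightarrow> complex \<Rightarrow> complex" where
  "rho_hat a b \<alpha>1 \<alpha>2 lam1 lam2 \<theta> s =
     1 - of_real \<theta> - of_real \<theta> * of_real (sqrt ((\<alpha>1 * lam1) / (\<alpha>2 * lam2))) *
       coth (csqrt (of_real \<alpha>1 * s / of_real lam1) * of_real a) *
       tanh (csqrt (of_real \<alpha>2 * s / of_real lam2) * of_real b)"

definition euler_symbol :: "real \<Rightarrow> real \<Rightarrow> real \<Rightarrow> complex" where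
  "euler_symbol \<Delta>t r \<omega> = (1 - exp (- of_real (r * \<Delta>t) - \<i> * of_real \<omega>)) / of_real \<Delta>t"

lemma Re_euler_symbol_pos:
  assumes "\<Delta>t > 0" "r > 0"
  shows "Re (euler_symbol \<Delta>t r \<omega>) > 0"
proof -
  have "Re (exp (- of_real (r * \<Delta>t) - \<i> * of_real \<omega>)) \<le> exp (- (r * \<Delta>t))"
    by (rule order_trans[OF complex_Re_le_cmod]) simp
  also have "\<dots> < 1" using assms by simp
  finally show ?thesis
    using assms by (simp add: euler_symbol_def)
qed

lemma Re_csqrt_pos:
  assumes "Re z > 0"
  shows "Re (csqrt z) > 0"
proof -
  have "Re z = (Re (csqrt z))\<^sup>2 - (Im (csqrt z))\<^sup>2"
    by (metis Re_power2 power2_csqrt)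
  then have "Re (csqrt z) \<noteq> 0"
    using assms by (metis diff_0 neg_0_less_iff_less not_less zero_le_power2 zero_power2)
  then show ?thesis
    using Re_csqrt[of z] by simp
qed

lemma cosh_sinh_nonzero:
  fixes z :: complex
  assumes "Re z > 0"
  shows "cosh z \<noteq> 0" "sinh z \<noteq> 0"
proof -
  have "norm (exp (- z)) < norm (exp z)"
    using assms by (simp add: norm_exp_eq_Re)
  then have "exp z \<noteq> exp (- z)" "exp z \<noteq> - exp (- z)"
    by (metis less_irrefl, metis less_irrefl norm_minus_cancel)
  then show "cosh z \<noteq> 0" "sinh z \<noteq> 0"
    by (auto simp: cosh_def sinh_def add_eq_0_iff2)
qed

text \<open>
  Standing in for the maximum over frequencies, the real supremum in the error bound is attained;
  so it is not the junk value of an unbounded set.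
\<close>

lemma rho_hat_SUP_attained:
  fixes a b \<alpha>1 \<alpha>2 lam1 lam2 \<theta> \<Delta>t r :: real and k :: nat
  assumes "a > 0" "b > 0" "\<alpha>1 > 0" "\<alpha>2 > 0" "lam1 > 0" "lam2 > 0" "\<Delta>t > 0" "r > 0"
  defines "f \<equiv> \<lambda>\<omega>. cmod (rho_hat a b \<alpha>1 \<alpha>2 lam1 lam2 \<theta> (euler_symbol \<Delta>t r \<omega>) ^ k)"
  obtains \<omega> where "\<omega> \<in> {-pi..pi}" "\<And>w. w \<in> {-pi..pi} \<Longrightarrow> f w \<le> f \<omega>"
    "(SUP w\<in>{-pi..pi}. f w) = f \<omega>"
proof -
  have pos: "Re (of_real c * euler_symbol \<Delta>t r w / of_real d) > 0" if "c > 0" "d > 0" for c d w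
    using that Re_euler_symbol_pos[OF assms(7,8), of w] by simp
  have cont: "continuous_on S (\<lambda>w. csqrt (of_real c * euler_symbol \<Delta>t r w / of_real d) * of_real e)"
    if "c > 0" "d > 0" for c d e S
  proof (rule continuous_on_mult_right, rule continuous_on_compose2[of "{z. Re z > 0}" csqrt])
    show "continuous_on {z. Re z > 0} csqrt"
      by (intro continuous_at_imp_continuous_on ballI continuous_at_csqrt)
        (auto simp: complex_nonpos_Reals_iff)
    show "continuous_on S (\<lambda>w. of_real c * euler_symbol \<Delta>t r w / of_real d)"
      using that assms unfolding euler_symbol_def by (intro continuous_intros) auto
  qed (use pos that in auto)
  have re: "Re (csqrt (of_real c * euler_symbol \<Delta>t r w / of_real d) * of_real e) > 0"
    if "c > 0" "d > 0" "e > 0" for c d e w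
    using Re_csqrt_pos[OF pos[OF that(1,2)]] that(3) by simp
  have C: "continuous_on S (\<lambda>w. coth (csqrt (of_real c * euler_symbol \<Delta>t r w / of_real d) * of_real e))"
    if "c > 0" "d > 0" "e > 0" for c d e S
    unfolding coth_def
    by (intro continuous_on_divide continuous_on_cosh continuous_on_sinh cont that ballI
          cosh_sinh_nonzero re)
  have T: "continuous_on S (\<lambda>w. tanh (csqrt (of_real c * euler_symbol \<Delta>t r w / of_real d) * of_real e))"
    if "c > 0" "d > 0" "e > 0" for c d e S
    unfolding tanh_def
    by (intro continuous_on_divide continuous_on_cosh continuous_on_sinh cont that ballI
          cosh_sinh_nonzero re)
  have "continuous_on {-pi..pi} f"
    unfolding f_def rho_hat_def
    by (intro continuous_on_norm continuous_on_power continuous_on_diff continuous_on_mult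
          continuous_on_const C T assms(1-6))
  then obtain \<omega> where \<omega>: "\<omega> \<in> {-pi..pi}" "\<And>w. w \<in> {-pi..pi} \<Longrightarrow> f w \<le> f \<omega>"
    using continuous_attains_sup[of "{-pi..pi}" f] by auto
  moreover have "(SUP w\<in>{-pi..pi}. f w) = f \<omega>"
    using \<omega> by (intro cSup_eq_maximum) auto
  ultimately show thesis using that by blast
qed

end

theory Submission
  imports Defs "HOL-Complex_Analysis.Complex_Analysis"
begin

text \<open>
  Replace the interface vector \<open>g\<close> by its generating polynomial \<open>G(z) = \<Sum>n=1..N. g n * z ^ n\<close>. Shifting
  by one time level is multiplication by \<open>z\<close>, up to the term of order \<open>N + 1\<close> that falls off the end,
  so the Euler scheme turns into one boundary value problem per \<open>z\<close>, the Laplace-transformed heat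
  equation at \<open>s = (1 - z) / \<Delta>t\<close>, with a source of size \<open>O(z ^ Suc N)\<close>. Testing it with
  \<open>sinh (\<kappa> * (x - p))\<close>, where \<open>p\<close> is the outer endpoint, yields the Dirichlet-to-Neumann map without
  constructing any solution: the Wronskian of the two functions changes across the interval only by
  the contribution of the source (\<open>heat_transform_boundary_bound\<close>). Eliminating the common flux leaves
  \<open>H(z) = R(z) * G(z) + O(z ^ Suc N)\<close> for one step, where \<open>R(z)\<close> is \<open>rho_hat\<close> at \<open>s\<close>
  (\<open>dnwr_step_symbol\<close>), and hence \<open>R ^ k\<close> in place of \<open>R\<close> for \<open>k\<close> steps.

  Since \<open>R\<close> is holomorphic in the unit disc, \<open>R ^ k\<close> may be replaced by a Taylor polynomial \<open>P\<close> that is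
  uniformly close to it on the circle of radius \<open>q < 1\<close>; then \<open>H\<close> and \<open>P * G\<close> agree up to degree \<open>N\<close>.
  Parseval's identity on that circle bounds the weighted norm with weights \<open>q ^ n\<close>
  (\<open>l2_bound_of_truncated_multiplier\<close>). For \<open>q = exp (- (r * \<Delta>t))\<close> the values of \<open>R\<close> on the circle are
  those of \<open>rho_hat\<close> at the Euler symbol, and removing the weights costs \<open>1 / q ^ N = exp (r * T)\<close>.
\<close>

section \<open>Boundary relations for the transformed heat equation\<close>

text \<open>
  Boundary fluxes are one-sided derivatives, while the differential equation is given in the open
  interval only. Since \<open>g\<close> is continuous up to the boundary, \<open>f\<close> differs from the twofold integral of
  \<open>g\<close> by an affine function in the interior, hence by continuity on the closed interval.
\<close>

lemma derivative_equation_up_to_boundary: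
  fixes f f' g :: "real \<Rightarrow> real"
  assumes lr: "l < r"
    and f: "\<And>x. x \<in> {l..r} \<Longrightarrow> (f has_real_derivative f' x) (at x within {l..r})"
    and f': "\<And>x. x \<in> {l<..<r} \<Longrightarrow> (f' has_real_derivative g x) (at x)"
    and g: "continuous_on {l..r} g"
    and x: "x \<in> {l..r}"
  shows "(f' has_real_derivative g x) (at x within {l..r})"
proof -
  define G where "G = (\<lambda>x. integral {l..x} g)"
  define H where "H = (\<lambda>x. integral {l..x} G)"
  have G: "(G has_real_derivative g t) (at t within {l..r})" if "t \<in> {l..r}" for t
    unfolding G_def using integral_has_real_derivative[OF g that] .
  then have "continuous_on {l..r} G"
    by (rule DERIV_continuous_on)
  then have H: "(H has_real_derivative G t) (at t within {l..r})" if "t \<in> {l..r}" for t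
    unfolding H_def using integral_has_real_derivative that by blast
  have inner: "at t within {l..r} = at t" if "t \<in> {l<..<r}" for t
    using that by (intro at_within_interior) auto
  have "((\<lambda>t. f' t - G t) has_real_derivative 0) (at t within {l<..<r})" if "t \<in> {l<..<r}" for t
    using DERIV_diff[OF f'[OF that] G[of t, unfolded inner[OF that]]] that
    by (auto intro: has_field_derivative_at_within)
  then obtain c where c: "\<And>t. t \<in> {l<..<r} \<Longrightarrow> f' t - G t = c"
    using has_field_derivative_zero_constant[of "{l<..<r}" "\<lambda>t. f' t - G t"] by auto
  define D where "D = (\<lambda>t. f t - H t - c * t)"
  have D: "(D has_real_derivative f' t - G t - c) (at t within {l..r})" if "t \<in> {l..r}" for t
    unfolding D_def by (rule derivative_eq_intros f[OF that] H[OF that] refl | simp)+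
  have const: "D t = D l" if "t \<in> {l..r}" for t
  proof (rule DERIV_isconst2[OF lr])
    show "continuous_on {l..r} D"
      using D by (rule DERIV_continuous_on)
    show "DERIV D t :> 0" if "l < t" "t < r" for t
      using D[of t] inner[of t] c[of t] that by simp
  qed (use that in auto)
  have eq: "f' t = G t + c" if t: "t \<in> {l..r}" for t
  proof -
    have "((\<lambda>_. D l) has_real_derivative f' t - G t - c) (at t within {l..r})"
      by (rule has_field_derivative_transform_within[OF D[OF t] zero_less_one t]) (rule const)
    then have "f' t - G t - c = 0"
      using vector_derivative_unique_within[of t "{l..r}" "\<lambda>_. D l" "f' t - G t - c" 0] lr t
      by (auto simp: has_real_derivative_iff_has_vector_derivative at_within_Icc_at_right
            trivial_limit_within islimpt_Icc)
    then show ?thesis by simp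
  qed
  have "((\<lambda>t. G t + c) has_real_derivative g x) (at x within {l..r})"
    using G[OF x] by (auto intro!: derivative_eq_intros)
  then show ?thesis
    by (rule has_field_derivative_transform_within[OF _ zero_less_one x]) (use eq in auto)
qed

lemma norm_sinh_le_exp_norm:
  fixes z :: complex
  shows "cmod (sinh z) \<le> exp (cmod z)"
proof -
  have "cmod (sinh z) = cmod (exp z - exp (- z)) / 2"
    by (simp add: sinh_def norm_divide scaleR_conv_of_real)
  also have "\<dots> \<le> (cmod (exp z) + cmod (exp (- z))) / 2"
    by (intro divide_right_mono norm_triangle_ineq4) simp
  also have "\<dots> \<le> (exp (cmod z) + exp (cmod z)) / 2"
    using add_mono[OF norm_exp[of z] norm_exp[of "- z"]]
    by (intro divide_right_mono) (simp_all only: norm_minus_cancel zero_le_numeral)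
  also have "\<dots> = exp (cmod z)" by simp
  finally show ?thesis .
qed

text \<open>
  \<open>W\<close> is the Wronskian of \<open>U\<close> and the solution \<open>\<phi> = sinh (\<kappa> * (x - p))\<close> of the homogeneous equation, so
  \<open>W' = F * \<phi>\<close>. Without a source, \<open>W r = W l\<close> would be an exact relation between the boundary data.
\<close>

lemma sinh_wronskian_increment_le:
  fixes U U' F :: "real \<Rightarrow> complex" and \<kappa> :: complex
  assumes lr: "l < r" and p: "p \<in> {l..r}"
    and U: "\<And>x. x \<in> {l..r} \<Longrightarrow> (U has_vector_derivative U' x) (at x within {l..r})"
    and U': "\<And>x. x \<in> {l..r} \<Longrightarrow> (U' has_vector_derivative \<kappa>\<^sup>2 * U x + F x) (at x within {l..r})"
    and F: "\<And>x. x \<in> {l..r} \<Longrightarrow> cmod (F x) \<le> B"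
  defines "W \<equiv> \<lambda>x. U' x * sinh (\<kappa> * of_real (x - p)) - U x * (\<kappa> * cosh (\<kappa> * of_real (x - p)))"
  shows "cmod (W r - W l) \<le> B * exp (cmod \<kappa> * (r - l)) * (r - l)"
proof -
  let ?\<phi> = "\<lambda>x. sinh (\<kappa> * of_real (x - p))"
  let ?\<psi> = "\<lambda>x. \<kappa> * cosh (\<kappa> * of_real (x - p))"
  have arg: "((\<lambda>x. \<kappa> * of_real (x - p)) has_vector_derivative \<kappa>) (at x within {l..r})" for x :: real
    by (auto intro!: derivative_eq_intros)
  have DS: "(sinh has_field_derivative cosh z) (at z)"
    and DC: "(cosh has_field_derivative sinh z) (at z)" for z :: complex
    by (auto intro!: derivative_eq_intros)
  have \<phi>: "(?\<phi> has_vector_derivative ?\<psi> x) (at x within {l..r})" for x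
    using field_vector_diff_chain_within[OF arg
        has_field_derivative_at_within[OF DS[of "\<kappa> * of_real (x - p)"]]]
    by (simp add: o_def)
  have \<psi>: "(?\<psi> has_vector_derivative \<kappa>\<^sup>2 * ?\<phi> x) (at x within {l..r})" for x
  proof -
    have "((\<lambda>x. cosh (\<kappa> * of_real (x - p))) has_vector_derivative \<kappa> * ?\<phi> x) (at x within {l..r})"
      using field_vector_diff_chain_within[OF arg
          has_field_derivative_at_within[OF DC[of "\<kappa> * of_real (x - p)"]]]
      by (simp add: o_def)
    from has_vector_derivative_mult_right[OF this, of \<kappa>]
    show ?thesis by (simp add: power2_eq_square mult.assoc)
  qed
  have W: "(W has_vector_derivative F x * ?\<phi> x) (at x within {l..r})" if "x \<in> {l..r}" for x
    unfolding W_def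
    using has_vector_derivative_diff[OF has_vector_derivative_mult[OF U'[OF that] \<phi>]
        has_vector_derivative_mult[OF U[OF that] \<psi>]]
    by (simp add: algebra_simps)
  have bd: "cmod (F x * ?\<phi> x) \<le> B * exp (cmod \<kappa> * (r - l))" if x: "x \<in> {l..r}" for x
  proof -
    have "\<bar>x - p\<bar> \<le> r - l" using x p by auto
    then have "cmod \<kappa> * \<bar>x - p\<bar> \<le> cmod \<kappa> * (r - l)"
      by (intro mult_left_mono) auto
    then have "cmod (?\<phi> x) \<le> exp (cmod \<kappa> * (r - l))"
      by (intro order_trans[OF norm_sinh_le_exp_norm]) (simp add: norm_mult flip: of_real_diff)
    moreover have "0 \<le> B"
      using F[OF x] norm_ge_zero[of "F x"] by linarith
    ultimately show ?thesis
      using F[OF x] unfolding norm_mult by (intro mult_mono) simp_all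
  qed
  have "cmod (W r - W l) \<le> B * exp (cmod \<kappa> * (r - l)) * cmod (of_real r - of_real l :: complex)"
    using differentiable_bound[of "{l..r}" W "\<lambda>x h. h *\<^sub>R (F x * ?\<phi> x)"
        "B * exp (cmod \<kappa> * (r - l))" r l] W lr bd
    by (auto simp: has_vector_derivative_def onorm_scaleR_left bounded_linear_ident onorm_id
        simp flip: of_real_diff)
  then show ?thesis using lr by (simp flip: of_real_diff)
qed

definition gen_poly :: "nat \<Rightarrow> (nat \<Rightarrow> real) \<Rightarrow> complex poly" where
  "gen_poly N v = (\<Sum>n<N. monom (of_real (v (Suc n))) (Suc n))"

lemma poly_gen_poly: "poly (gen_poly N v) z = (\<Sum>n<N. of_real (v (Suc n)) * z ^ Suc n)"
  by (simp add: gen_poly_def poly_sum poly_monom)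

lemma coeff_gen_poly: "coeff (gen_poly N v) n = (if n \<in> {1..N} then of_real (v n) else 0)"
proof (cases n)
  case (Suc m)
  then show ?thesis by (simp add: gen_poly_def coeff_sum coeff_monom)
qed (simp add: gen_poly_def coeff_sum coeff_monom)

text \<open>
  The term subtracted from \<open>z * G(z)\<close> is the last entry, which the shift moves past the end of the
  vector. It is the only source of inexactness in the transform of the time stepping.
\<close>

lemma gen_poly_shift:
  assumes "v 0 = 0"
  shows "(\<Sum>n<N. of_real (v n) * z ^ Suc n) = z * poly (gen_poly N v) z - of_real (v N) * z ^ Suc N"
  using assms by (induction N) (simp_all add: poly_gen_poly algebra_simps)

lemma gen_poly_cong: "(\<And>n. n < N \<Longrightarrow> v (Suc n) = w (Suc n)) \<Longrightarrow> gen_poly N v = gen_poly N w"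
  by (simp add: gen_poly_def)

lemma poly_gen_poly_linear:
  "poly (gen_poly N (\<lambda>n. c * v n + d * w n)) z
    = of_real c * poly (gen_poly N v) z + of_real d * poly (gen_poly N w) z"
  by (simp add: poly_gen_poly sum_distrib_left sum.distrib algebra_simps)

text \<open>
  The generating polynomial \<open>U\<close> of the time levels satisfies \<open>U'' = \<kappa>\<^sup>2 * U + F\<close> with a source \<open>F\<close> that
  comes from the last time level alone and carries the factor \<open>z ^ Suc N\<close>. The bound is uniform in \<open>z\<close>
  because \<open>\<kappa>\<close> is bounded on the unit disc.
\<close>

lemma heat_transform_boundary_bound:
  fixes u u' :: "nat \<Rightarrow> real \<Rightarrow> real"
  assumes pos: "\<alpha> > 0" "lam > 0" "\<Delta>t > 0" and lr: "l < r" and p: "p \<in> {l..r}"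
    and u0: "\<forall>x\<in>{l..r}. u 0 x = 0"
    and step: "\<And>n. n < N \<Longrightarrow> heat_euler_step \<alpha> lam \<Delta>t l r (u n) (u (Suc n)) (u' (Suc n))"
  obtains C where "\<And>z \<kappa> U U' W. cmod z < 1 \<Longrightarrow>
      \<kappa> = csqrt (of_real \<alpha> * ((1 - z) / of_real \<Delta>t) / of_real lam) \<Longrightarrow>
      U = (\<lambda>x. poly (gen_poly N (\<lambda>n. u n x)) z) \<Longrightarrow>
      U' = (\<lambda>x. poly (gen_poly N (\<lambda>n. u' n x)) z) \<Longrightarrow>
      W = (\<lambda>x. U' x * sinh (\<kappa> * of_real (x - p)) - U x * (\<kappa> * cosh (\<kappa> * of_real (x - p)))) \<Longrightarrow>
      cmod (W r - W l) \<le> C * cmod z ^ Suc N"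
proof -
  define c where "c = \<alpha> / (\<Delta>t * lam)"
  have c: "c > 0" using pos by (simp add: c_def)
  have du: "(u (Suc n) has_real_derivative u' (Suc n) x) (at x within {l..r})"
    if "n < N" "x \<in> {l..r}" for n x
    using step[OF that(1)] that(2) by (simp add: heat_euler_step_def)
  have cont: "continuous_on {l..r} (u n)" if "n \<le> N" for n
  proof (cases n)
    case 0
    then show ?thesis
      using u0 continuous_on_cong[of "{l..r}" "{l..r}" "u 0" "\<lambda>_. 0"] by auto
  next
    case (Suc m)
    with that have "m < N" by simp
    with Suc show ?thesis using DERIV_continuous_on[OF du[of m]] by simp
  qed
  have ddu: "(u' (Suc n) has_real_derivative c * (u (Suc n) x - u n x)) (at x within {l..r})"
    if n: "n < N" and x: "x \<in> {l..r}" for n x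
  proof (rule derivative_equation_up_to_boundary[OF lr du[OF n] _ _ x])
    show "continuous_on {l..r} (\<lambda>x. c * (u (Suc n) x - u n x))"
      using n by (intro continuous_intros cont) auto
    fix y assume "y \<in> {l<..<r}"
    then obtain d where d: "(u' (Suc n) has_real_derivative d) (at y)"
        "\<alpha> / \<Delta>t * (u (Suc n) y - u n y) - lam * d = 0"
      using step[OF n] unfolding heat_euler_step_def by blast
    then have "d = c * (u (Suc n) y - u n y)"
      using pos by (simp add: c_def field_simps)
    with d show "(u' (Suc n) has_real_derivative c * (u (Suc n) y - u n y)) (at y)" by simp
  qed
  have "bounded (u N ` {l..r})"
    by (intro compact_imp_bounded compact_continuous_image cont) auto
  then obtain B where B: "\<And>x. x \<in> {l..r} \<Longrightarrow> \<bar>u N x\<bar> \<le> B"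
    unfolding bounded_iff by (metis image_eqI real_norm_def)
  have "0 \<le> B" using B[OF p] by linarith
  define K where "K = exp (sqrt (2 * c) * (r - l)) * (r - l)"
  show thesis
  proof (rule that[of "c * B * K"])
    fix z \<kappa> U U' W
    assume z: "cmod z < 1" and \<kappa>: "\<kappa> = csqrt (of_real \<alpha> * ((1 - z) / of_real \<Delta>t) / of_real lam)"
      and U: "U = (\<lambda>x. poly (gen_poly N (\<lambda>n. u n x)) z)"
      and U': "U' = (\<lambda>x. poly (gen_poly N (\<lambda>n. u' n x)) z)"
      and W: "W = (\<lambda>x. U' x * sinh (\<kappa> * of_real (x - p)) - U x * (\<kappa> * cosh (\<kappa> * of_real (x - p))))"
    define F where "F = (\<lambda>x. of_real (c * u N x) * z ^ Suc N)"
    have \<kappa>2: "\<kappa>\<^sup>2 = of_real c * (1 - z)"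
      by (simp add: \<kappa> c_def)
    have "cmod (1 - z) \<le> 2"
      using norm_triangle_ineq4[of 1 z] z by simp
    then have "cmod (\<kappa>\<^sup>2) \<le> 2 * c"
      using c by (simp add: \<kappa>2 norm_mult)
    then have \<kappa>_le: "cmod \<kappa> \<le> sqrt (2 * c)"
      by (simp add: norm_power real_le_rsqrt)
    have dU: "(U has_vector_derivative U' x) (at x within {l..r})" if "x \<in> {l..r}" for x
      unfolding U U' poly_gen_poly
      using du that
      by (intro has_vector_derivative_sum has_vector_derivative_mult_left has_vector_derivative_of_real)
        (auto simp: has_real_derivative_iff_has_vector_derivative)
    have ode: "(\<Sum>n<N. of_real (c * (u (Suc n) x - u n x)) * z ^ Suc n) = \<kappa>\<^sup>2 * U x + F x"
      if "x \<in> {l..r}" for x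
    proof -
      have "(\<Sum>n<N. of_real (c * (u (Suc n) x - u n x)) * z ^ Suc n)
          = of_real c * (U x - (\<Sum>n<N. of_real (u n x) * z ^ Suc n))"
        by (simp add: U poly_gen_poly sum_distrib_left algebra_simps flip: sum_subtractf)
      also have "(\<Sum>n<N. of_real (u n x) * z ^ Suc n) = z * U x - of_real (u N x) * z ^ Suc N"
        using gen_poly_shift[of "\<lambda>n. u n x"] u0 that by (simp add: U)
      finally show ?thesis by (simp add: \<kappa>2 F_def algebra_simps)
    qed
    have ddU: "(U' has_vector_derivative \<kappa>\<^sup>2 * U x + F x) (at x within {l..r})"
      if x: "x \<in> {l..r}" for x
      unfolding U' poly_gen_poly ode[OF x, symmetric]
      using ddu x
      by (intro has_vector_derivative_sum has_vector_derivative_mult_left has_vector_derivative_of_real)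
        (auto simp: has_real_derivative_iff_has_vector_derivative)
    have F: "cmod (F x) \<le> c * B * cmod z ^ Suc N" if "x \<in> {l..r}" for x
      using c B[OF that] 
      by (auto simp: F_def norm_mult norm_power abs_mult intro!: mult_mono)
    have "cmod (W r - W l) \<le> c * B * cmod z ^ Suc N * exp (cmod \<kappa> * (r - l)) * (r - l)"
      unfolding W using sinh_wronskian_increment_le[OF lr p dU ddU F] .
    also have "\<dots> \<le> c * B * cmod z ^ Suc N * exp (sqrt (2 * c) * (r - l)) * (r - l)"
      using lr c \<open>0 \<le> B\<close> \<kappa>_le by (intro mult_right_mono mult_left_mono) auto
    finally show "cmod (W r - W l) \<le> c * B * K * cmod z ^ Suc N"
      by (simp add: K_def mult_ac)
  qed
qed

section \<open>Parseval bound for holomorphic multipliers\<close>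

lemma coeff_eq_0_if_poly_bigo:
  fixes p :: "complex poly"
  assumes "poly p \<in> O[at 0](\<lambda>z. z ^ m)" and "n < m"
  shows "coeff p n = 0"
  using assms
proof (induction m arbitrary: p n)
  case (Suc m)
  obtain a q where p: "p = pCons a q" by (cases p)
  have "((\<lambda>z. z ^ Suc m) \<longlongrightarrow> 0) (at (0::complex))"
    by (auto intro!: tendsto_eq_intros)
  moreover have "(\<lambda>z. z ^ Suc m) \<in> o[at (0::complex)](\<lambda>_. 1)"
    by (rule smalloI_tendsto) (use calculation in auto)
  ultimately have "poly p \<in> o[at 0](\<lambda>_. 1)"
    using Suc.prems(1) by (meson landau_o.big_small_trans)
  then have "(poly p \<longlongrightarrow> 0) (at 0)"
    by (auto dest!: smalloD_tendsto)
  moreover have "(poly p \<longlongrightarrow> poly p 0) (at 0)"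
    using poly_isCont[of 0 p] by (simp add: isCont_def)
  ultimately have "poly p 0 = 0"
    using tendsto_unique trivial_limit_at by blast
  then have a: "a = 0" by (simp add: p)
  have "(\<lambda>z. z * poly q z) \<in> O[at 0](\<lambda>z. z * z ^ m)"
    using Suc.prems(1) by (simp add: p a)
  moreover have "eventually (\<lambda>z. z \<noteq> 0) (at (0::complex))"
    by (auto simp: eventually_at_filter)
  ultimately have "poly q \<in> O[at 0](\<lambda>z. z ^ m)"
    using landau_o.big.mult_cancel_left[of "\<lambda>z. z" "at (0::complex)" "\<lambda>z. z"] by simp
  with Suc.IH[of q] Suc.prems(2) show ?case
    by (cases n) (auto simp: p a)
next
  case 0
  from 0(2) show ?case by simp
qed

lemma sum_powers_root_of_unity:
  fixes m n M :: nat
  assumes "m < M" "n < M"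
  shows "(\<Sum>j<M. (cis (2 * pi * real j / real M)) ^ m * cnj (cis (2 * pi * real j / real M) ^ n)) = (if m = n then of_nat M else 0)"
proof -
  define \<zeta> where "\<zeta> = cis (2 * pi * (real m - real n) / real M)"
  have M: "M > 0" using assms by simp
  have "cis (2 * pi * real j / real M) ^ m * cnj (cis (2 * pi * real j / real M) ^ n) = \<zeta> ^ j" for j :: nat
    by (simp add: \<zeta>_def Complex.DeMoivre cis_mult cis_cnj diff_divide_distrib algebra_simps)
  then have sum: "(\<Sum>j<M. cis (2 * pi * real j / real M) ^ m * cnj (cis (2 * pi * real j / real M) ^ n)) = (\<Sum>j<M. \<zeta> ^ j)"
    by simp
  show ?thesis
  proof (cases "m = n")
    case True
    then show ?thesis unfolding sum by (simp add: \<zeta>_def)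
  next
    case False
    have "\<zeta> \<noteq> 1"
    proof
      assume "\<zeta> = 1"
      then have "cos (2 * pi * (real m - real n) / real M) = 1"
        by (simp add: \<zeta>_def complex_eq_iff)
      then obtain k :: int where "2 * pi * (real m - real n) / M = real_of_int k * 2 * pi"
        using cos_one_2pi_int by blast
      then have "2 * pi * ((real m - real n) / real M) = 2 * pi * real_of_int k"
        by (simp add: mult_ac)
      then have "(real m - real n) / M = real_of_int k"
        by (rule mult_left_cancel[THEN iffD1, rotated]) simp
      then have "real m - real n = real_of_int k * M"
        using M by (simp add: field_simps)
      then have "real_of_int (int m - int n) = real_of_int (k * int M)"
        by simp
      then have "int m - int n = k * int M"
        using of_int_eq_iff by blast
      moreover have "\<bar>int m - int n\<bar> < int M" "int m - int n \<noteq> 0"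
        using assms False by auto
      ultimately show False
        by (metis dvd_imp_le_int dvd_triv_right abs_of_nat linorder_not_less)
    qed
    moreover have "\<zeta> ^ M = 1"
    proof -
      have "\<zeta> ^ M = cis (2 * pi * (real m - real n))"
        using M by (simp add: \<zeta>_def Complex.DeMoivre)
      also have "\<dots> = 1"
        by (rule cis_multiple_2pi) auto
      finally show ?thesis .
    qed
    ultimately show ?thesis
      unfolding sum using False geometric_sum[of \<zeta> M] by simp
  qed
qed

text \<open>
  Distinct monomials of degree below \<open>M\<close> are orthogonal on \<open>M\<close> equally spaced points of a circle, so
  finite sums take the place of the integral over the circle.
\<close>

lemma discrete_parseval_poly:
  fixes p :: "complex poly"
  assumes "degree p < M"
  shows "(\<Sum>j<M. (cmod (poly p (of_real q * cis (2 * pi * real j / real M))))\<^sup>2)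
    = real M * (\<Sum>n<M. (cmod (coeff p n) * \<bar>q\<bar> ^ n)\<^sup>2)"
proof -
  define c where "c = (\<lambda>n. coeff p n * of_real q ^ n)"
  have P: "poly p (of_real q * w) = (\<Sum>n<M. c n * w ^ n)" for w
    unfolding poly_altdef c_def using assms
    by (intro sum.mono_neutral_cong_left) (auto simp: coeff_eq_0 power_mult_distrib)
  let ?w = "\<lambda>j. cis (2 * pi * real j / M)"
  have "of_real (\<Sum>j<M. (cmod (poly p (of_real q * ?w j)))\<^sup>2)
      = (\<Sum>j<M. (\<Sum>m<M. c m * ?w j ^ m) * cnj (\<Sum>n<M. c n * ?w j ^ n))"
    by (simp only: of_real_sum P complex_norm_square)
  also have "\<dots> = (\<Sum>j<M. \<Sum>m<M. \<Sum>n<M. c m * cnj (c n) * (?w j ^ m * cnj (?w j ^ n)))"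
    by (simp add: sum_product mult_ac)
  also have "\<dots> = (\<Sum>m<M. \<Sum>j<M. \<Sum>n<M. c m * cnj (c n) * (?w j ^ m * cnj (?w j ^ n)))"
    by (rule sum.swap)
  also have "\<dots> = (\<Sum>m<M. \<Sum>n<M. \<Sum>j<M. c m * cnj (c n) * (?w j ^ m * cnj (?w j ^ n)))"
    by (intro sum.cong sum.swap refl)
  also have "\<dots> = (\<Sum>m<M. \<Sum>n<M. c m * cnj (c n) * (if m = n then of_nat M else 0))"
    by (intro sum.cong refl) (simp only: sum_distrib_left[symmetric] lessThan_iff sum_powers_root_of_unity)
  also have "\<dots> = (\<Sum>m<M. of_nat M * (c m * cnj (c m)))"
    by (intro sum.cong refl) (simp add: if_distrib cong: if_cong)
  also have "\<dots> = of_real (M * (\<Sum>n<M. (cmod (c n))\<^sup>2))"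
    by (simp only: of_real_mult of_real_sum of_real_of_nat_eq complex_norm_square sum_distrib_left)
  finally have "(\<Sum>j<M. (cmod (poly p (of_real q * ?w j)))\<^sup>2) = M * (\<Sum>n<M. (cmod (c n))\<^sup>2)"
    unfolding of_real_eq_iff .
  then show ?thesis by (simp add: c_def norm_mult norm_power)
qed

text \<open>
  A Taylor polynomial of high enough degree does both jobs at once: it matches \<open>f\<close> to a prescribed
  order at the origin, and it is uniformly close to \<open>f\<close> on a smaller disc.
\<close>

lemma holomorphic_poly_approximation:
  assumes f: "f holomorphic_on ball 0 1" and q: "q < 1" and \<epsilon>: "\<epsilon> > 0"
  obtains P :: "complex poly" where "(\<lambda>z. f z - poly P z) \<in> O[at 0](\<lambda>z. z ^ m)"
    "\<And>z. cmod z \<le> q \<Longrightarrow> cmod (f z - poly P z) \<le> \<epsilon>"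
proof -
  define a where "a = fps_nth (fps_expansion f 0)"
  have f': "f holomorphic_on eball 0 1"
    using f by (simp add: eball_def ball_def flip: one_ereal_def)
  have rad: "conv_radius a \<ge> 1"
    using conv_radius_fps_expansion[OF f'] by (simp add: a_def fps_conv_radius_def)
  have sums: "(\<lambda>n. a n * z ^ n) sums f z" if "cmod z < 1" for z
  proof -
    have "summable (\<lambda>n. a n * z ^ n)"
      using that rad less_le_trans[of "ereal (cmod z)" 1]
      by (intro summable_in_conv_radius) (auto simp: one_ereal_def)
    moreover have "(\<Sum>n. a n * z ^ n) = f z"
      using eval_fps_expansion'[OF f', of z] that by (simp add: eval_fps_def a_def one_ereal_def)
    ultimately show ?thesis by (simp add: sums_iff)
  qed
  define T where "T = (\<lambda>L. \<Sum>n<L. monom (a n) n)"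
  have T: "poly (T L) z = (\<Sum>n<L. a n * z ^ n)" for L z
    by (simp add: T_def poly_sum poly_monom)
  have "ereal q < conv_radius a"
    using q rad less_le_trans[of "ereal q" 1] by (auto simp: one_ereal_def)
  from powser_uniform_limit[OF this, of 0]
  have "uniform_limit (cball 0 q) (\<lambda>n z. \<Sum>i<n. a i * z ^ i) (\<lambda>z. \<Sum>i. a i * z ^ i) sequentially"
    by simp
  then have "eventually (\<lambda>L. \<forall>z\<in>cball 0 q. dist (\<Sum>i<L. a i * z ^ i) (\<Sum>i. a i * z ^ i) < \<epsilon>) sequentially"
    using \<epsilon> by (rule uniform_limitD)
  from eventually_conj[OF this eventually_ge_at_top[of m]] obtain L where
    L: "L \<ge> m" "\<And>z. z \<in> cball 0 q \<Longrightarrow> dist (\<Sum>i<L. a i * z ^ i) (\<Sum>i. a i * z ^ i) < \<epsilon>"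
    by (auto simp: eventually_sequentially)
  show thesis
  proof (rule that[of "T L"])
    fix z assume "cmod z \<le> q"
    moreover from this q have "(\<Sum>i. a i * z ^ i) = f z"
      using sums[of z] by (simp add: sums_iff)
    ultimately show "cmod (f z - poly (T L) z) \<le> \<epsilon>"
      using L(2)[of z] by (simp add: T dist_norm norm_minus_commute)
  next
    define C where "C = (\<Sum>n. cmod (a (n + L)) * (1/2) ^ n)"
    have "summable (\<lambda>n. cmod (a n * (1/2) ^ n))"
      using rad less_le_trans[of "ereal (1/2)" 1]
      by (intro abs_summable_in_conv_radius) (auto simp: one_ereal_def)
    then have "summable (\<lambda>n. cmod (a (n + L)) * (1/2) ^ (n + L))"
      by (subst summable_iff_shift) (simp add: norm_mult norm_power norm_divide)
    then have C: "summable (\<lambda>n. cmod (a (n + L)) * (1/2) ^ n)"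
      using summable_mult2[of "\<lambda>n. cmod (a (n + L)) * (1/2) ^ (n + L)" "2 ^ L"] by (simp add: power_add field_simps)
    have bound: "cmod (f z - poly (T L) z) \<le> C * cmod (z ^ m)" if z: "cmod z \<le> 1/2" for z
    proof -
      have le: "cmod (a (n + L) * z ^ (n + L)) \<le> cmod z ^ L * (cmod (a (n + L)) * (1/2) ^ n)" for n
      proof -
        have "cmod z ^ n \<le> (1/2) ^ n" using z by (intro power_mono) auto
        then have "cmod (a (n + L)) * cmod z ^ L * cmod z ^ n \<le> cmod (a (n + L)) * cmod z ^ L * (1/2) ^ n"
          by (intro mult_left_mono) auto
        then show ?thesis by (simp add: norm_mult norm_power power_add mult_ac)
      qed
      have "f z - poly (T L) z = (\<Sum>n. a (n + L) * z ^ (n + L))"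
        using suminf_split_initial_segment[of "\<lambda>n. a n * z ^ n" L] sums[of z] z
        by (simp add: T sums_iff)
      also have "cmod \<dots> \<le> (\<Sum>n. cmod z ^ L * (cmod (a (n + L)) * (1/2) ^ n))"
        by (rule norm_suminf_le[OF le summable_mult[OF C]])
      also have "\<dots> = C * cmod z ^ L"
        using suminf_mult[OF C] by (simp add: C_def mult.commute)
      also have "\<dots> \<le> C * cmod z ^ m"
        using z L(1) C by (intro mult_left_mono power_decreasing) (auto simp: C_def intro!: suminf_nonneg)
      finally show ?thesis by (simp add: norm_power)
    qed
    have "eventually (\<lambda>z. cmod z \<le> 1/2) (at (0::complex))"
      by (auto simp: eventually_at intro!: exI[of _ "1/2"])
    then show "(\<lambda>z. f z - poly (T L) z) \<in> O[at 0](\<lambda>z. z ^ m)"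
      by (intro bigoI[of _ C]) (auto elim!: eventually_mono intro: bound)
  qed
qed

text \<open>
  If \<open>f\<close> is a polynomial, then \<open>H\<close> and \<open>f * G\<close> have the same coefficients up to degree \<open>N\<close>.
  Dropping the higher ones does not increase the weighted norm of \<open>f * G\<close>, and Parseval's identity
  bounds that norm by means of the supremum of \<open>f\<close> on the circle. The
  general case follows by polynomial approximation.
\<close>

lemma l2_bound_of_truncated_multiplier:
  fixes H G :: "complex poly"
  assumes f: "f holomorphic_on ball 0 1" and q: "0 < q" "q < 1" and G: "degree G \<le> N"
    and rel: "(\<lambda>z. poly H z - f z * poly G z) \<in> O[at 0](\<lambda>z. z ^ Suc N)"
    and S: "\<And>z. cmod z = q \<Longrightarrow> cmod (f z) \<le> S"
  shows "(\<Sum>n\<le>N. (cmod (coeff H n) * q ^ n)\<^sup>2) \<le> S\<^sup>2 * (\<Sum>n\<le>N. (cmod (coeff G n) * q ^ n)\<^sup>2)"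
    (is "?h \<le> S\<^sup>2 * ?g")
proof -
  have "cmod (f (of_real q)) \<le> S"
    using q by (intro S) simp
  then have S0: "0 \<le> S"
    by (rule order_trans[OF norm_ge_zero])
  have approx: "?h \<le> (S + \<epsilon>)\<^sup>2 * ?g" if \<epsilon>: "\<epsilon> > 0" for \<epsilon>
  proof -
    obtain P where P: "(\<lambda>z. f z - poly P z) \<in> O[at 0](\<lambda>z. z ^ Suc N)"
      "\<And>z. cmod z \<le> q \<Longrightarrow> cmod (f z - poly P z) \<le> \<epsilon>"
      using holomorphic_poly_approximation[OF f q(2) \<epsilon>, of "Suc N"] by metis
    define Q where "Q = P * G"
    have "poly G \<in> O[at 0](\<lambda>_. 1)"
      by (intro continuous_imp_bigo_1 poly_isCont)
    from landau_o.big.mult[OF P(1) this]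
    have "(\<lambda>z. (f z - poly P z) * poly G z) \<in> O[at 0](\<lambda>z. z ^ Suc N)"
      by simp
    from sum_in_bigo(1)[OF rel this]
    have "(\<lambda>z. poly H z - f z * poly G z + (f z - poly P z) * poly G z) \<in> O[at 0](\<lambda>z. z ^ Suc N)" .
    moreover have "(\<lambda>z. poly H z - f z * poly G z + (f z - poly P z) * poly G z) = poly (H - Q)"
      by (rule ext) (simp add: Q_def algebra_simps)
    ultimately have "poly (H - Q) \<in> O[at 0](\<lambda>z. z ^ Suc N)"
      by (simp only:)
    then have coeffs: "coeff H n = coeff Q n" if "n \<le> N" for n
      using coeff_eq_0_if_poly_bigo[of "H - Q" "Suc N" n] that by simp
    \<comment> \<open>enough sample points for Parseval to hold for both \<open>Q\<close> and \<open>G\<close>, and for all \<open>n \<le> N\<close> to occur\<close>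
    define M where "M = Suc (N + degree Q + degree G)"
    have M: "degree Q < M" "degree G < M" "N < M"
      by (simp_all add: M_def)
    define w where "w = (\<lambda>j. of_real q * cis (2 * pi * real j / real M))"
    have w: "cmod (w j) = q" for j
      using q by (simp add: w_def norm_mult)
    have "?h = (\<Sum>n\<le>N. (cmod (coeff Q n) * q ^ n)\<^sup>2)"
      by (simp add: coeffs)
    also have "\<dots> \<le> (\<Sum>n<M. (cmod (coeff Q n) * q ^ n)\<^sup>2)"
      using M(3) by (intro sum_mono2) auto
    finally have "M * ?h \<le> M * (\<Sum>n<M. (cmod (coeff Q n) * q ^ n)\<^sup>2)"
      by (intro mult_left_mono) auto
    also have "\<dots> = (\<Sum>j<M. (cmod (poly Q (w j)))\<^sup>2)"
      using discrete_parseval_poly[OF M(1), of q] q by (simp add: w_def)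
    also have "\<dots> \<le> (\<Sum>j<M. (S + \<epsilon>)\<^sup>2 * (cmod (poly G (w j)))\<^sup>2)"
    proof (intro sum_mono)
      fix j
      have "cmod (poly P (w j)) \<le> cmod (f (w j)) + cmod (f (w j) - poly P (w j))"
        by (metis norm_triangle_sub norm_minus_commute)
      also have "\<dots> \<le> S + \<epsilon>"
        using S[of "w j"] P(2)[of "w j"] w by (intro add_mono) auto
      finally have "(cmod (poly P (w j)))\<^sup>2 \<le> (S + \<epsilon>)\<^sup>2"
        by (intro power_mono) auto
      then show "(cmod (poly Q (w j)))\<^sup>2 \<le> (S + \<epsilon>)\<^sup>2 * (cmod (poly G (w j)))\<^sup>2"
        by (simp add: Q_def norm_mult power_mult_distrib mult_right_mono)
    qed
    also have "\<dots> = (S + \<epsilon>)\<^sup>2 * (M * (\<Sum>n<M. (cmod (coeff G n) * q ^ n)\<^sup>2))"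
      using discrete_parseval_poly[OF M(2), of q] q by (simp add: w_def flip: sum_distrib_left)
    also have "(\<Sum>n<M. (cmod (coeff G n) * q ^ n)\<^sup>2) = ?g"
      using G M(3) by (intro sum.mono_neutral_right) (auto intro!: coeff_eq_0)
    finally have "real M * ?h \<le> real M * ((S + \<epsilon>)\<^sup>2 * ?g)"
      by (simp add: mult_ac)
    moreover have "real M > 0" using M(3) by simp
    ultimately show ?thesis by simp
  qed
  have lim: "((\<lambda>\<epsilon>. (S + \<epsilon>)\<^sup>2 * ?g) \<longlongrightarrow> (S + 0)\<^sup>2 * ?g) (at_right 0)"
    by (intro tendsto_intros)
  have "eventually (\<lambda>\<epsilon>. ?h \<le> (S + \<epsilon>)\<^sup>2 * ?g) (at_right 0)"
    using approx eventually_at_right_less[of "0::real"] by (auto elim: eventually_mono)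
  from tendsto_lowerbound[OF lim this] show ?thesis by simp
qed

section \<open>The symbol of the iteration\<close>

definition wave_number :: "real \<Rightarrow> real \<Rightarrow> complex \<Rightarrow> complex" where
  "wave_number \<alpha> lam s = csqrt (of_real \<alpha> * s / of_real lam)"

lemma Re_wave_number_pos: "\<alpha> > 0 \<Longrightarrow> lam > 0 \<Longrightarrow> Re s > 0 \<Longrightarrow> Re (wave_number \<alpha> lam s) > 0"
  unfolding wave_number_def by (intro Re_csqrt_pos) simp

lemma wave_number_eq:
  assumes "\<alpha> > 0" "lam > 0" "Re s > 0"
  shows "wave_number \<alpha> lam s = of_real (sqrt (\<alpha> / lam)) * csqrt s"
  unfolding wave_number_def
proof (rule csqrt_unique)
  show "(of_real (sqrt (\<alpha> / lam)) * csqrt s)\<^sup>2 = of_real \<alpha> * s / of_real lam"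
    using assms by (simp add: power_mult_distrib flip: of_real_power)
qed (use assms Re_csqrt_pos[of s] in auto)

lemma holomorphic_on_wave_number:
  assumes "\<alpha> > 0" "lam > 0" "f holomorphic_on A" "\<And>z. z \<in> A \<Longrightarrow> Re (f z) > 0"
  shows "(\<lambda>z. wave_number \<alpha> lam (f z)) holomorphic_on A"
  unfolding wave_number_def
proof (intro holomorphic_intros assms(3))
  fix z assume "z \<in> A"
  then have "Re (of_real \<alpha> * f z / of_real lam) > 0"
    using assms(1,2,4) by simp
  then show "of_real \<alpha> * f z / of_real lam \<notin> \<real>\<^sub>\<le>\<^sub>0"
    by (simp add: complex_nonpos_Reals_iff)
qed (use assms(2) in auto)

lemma wave_number_nonzero: "\<alpha> > 0 \<Longrightarrow> lam > 0 \<Longrightarrow> Re s > 0 \<Longrightarrow> wave_number \<alpha> lam s \<noteq> 0"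
  using Re_wave_number_pos[of \<alpha> lam s] by auto

lemma wave_number_cosh_sinh_nonzero:
  assumes "\<alpha> > 0" "lam > 0" "Re s > 0" "c > 0"
  shows "cosh (wave_number \<alpha> lam s * of_real c) \<noteq> 0" "sinh (wave_number \<alpha> lam s * of_real c) \<noteq> 0"
  by (intro cosh_sinh_nonzero, use assms Re_wave_number_pos[of \<alpha> lam s] in simp)+

lemma holomorphic_on_sinh_cosh:
  assumes "f holomorphic_on A"
  shows "(\<lambda>z. sinh (f z)) holomorphic_on A" "(\<lambda>z. cosh (f z)) holomorphic_on A"
  unfolding sinh_field_def cosh_field_def by (intro holomorphic_intros assms; simp)+

text \<open>
  In this form the coefficient is a quotient of fluxes \<open>lam * \<kappa>\<close>, as it arises from eliminating the
  common flux. Since \<open>csqrt\<close> is homogeneous under positive real factors, the square root of \<open>s\<close>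
  cancels in the quotient.
\<close>

lemma rho_hat_eq_wave_number_ratio:
  assumes "\<alpha>1 > 0" "\<alpha>2 > 0" "lam1 > 0" "lam2 > 0" "Re s > 0"
  defines "\<kappa>1 \<equiv> wave_number \<alpha>1 lam1 s" and "\<kappa>2 \<equiv> wave_number \<alpha>2 lam2 s"
  shows "rho_hat a b \<alpha>1 \<alpha>2 lam1 lam2 \<theta> s = 1 - of_real \<theta> - of_real \<theta> * (of_real lam1 * \<kappa>1 / (of_real lam2 * \<kappa>2)) *
     (cosh (\<kappa>1 * of_real a) / sinh (\<kappa>1 * of_real a)) * (sinh (\<kappa>2 * of_real b) / cosh (\<kappa>2 * of_real b))"
proof -
  have "lam1 * sqrt (\<alpha>1 / lam1) = sqrt (\<alpha>1 * lam1)" "lam2 * sqrt (\<alpha>2 / lam2) = sqrt (\<alpha>2 * lam2)"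
    using assms(1-4) by (simp_all add: real_sqrt_divide real_sqrt_mult field_simps)
  then have "sqrt (\<alpha>1 * lam1 / (\<alpha>2 * lam2)) = lam1 * sqrt (\<alpha>1 / lam1) / (lam2 * sqrt (\<alpha>2 / lam2))"
    by (simp add: real_sqrt_divide)
  moreover have "csqrt s \<noteq> 0" using assms by auto
  ultimately have "of_real (sqrt (\<alpha>1 * lam1 / (\<alpha>2 * lam2))) = of_real lam1 * \<kappa>1 / (of_real lam2 * \<kappa>2)"
    using assms by (simp add: wave_number_eq)
  then show ?thesis
    unfolding rho_hat_def coth_def tanh_def \<kappa>1_def \<kappa>2_def wave_number_def by simp
qed

lemma holomorphic_on_rho_hat:
  assumes pos: "a > 0" "b > 0" "\<alpha>1 > 0" "\<alpha>2 > 0" "lam1 > 0" "lam2 > 0"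
    and f: "f holomorphic_on A" "\<And>z. z \<in> A \<Longrightarrow> Re (f z) > 0"
  shows "(\<lambda>z. rho_hat a b \<alpha>1 \<alpha>2 lam1 lam2 \<theta> (f z)) holomorphic_on A"
  unfolding rho_hat_def coth_def tanh_def wave_number_def[symmetric]
  using pos f by (intro holomorphic_intros holomorphic_on_sinh_cosh holomorphic_on_wave_number wave_number_cosh_sinh_nonzero) auto

lemma Re_one_minus_pos: "\<Delta>t > 0 \<Longrightarrow> cmod z < 1 \<Longrightarrow> Re ((1 - z) / of_real \<Delta>t) > 0"
  using complex_Re_le_cmod[of z] by simp

text \<open>
  Up to \<open>O(z ^ Suc N)\<close>, the left subdomain turns the Dirichlet datum \<open>G\<close> into the
  derivative \<open>D = \<kappa>1 * coth (\<kappa>1 * a) * G\<close> at the interface, and the right one turns the derivative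
  \<open>\<mu> * D\<close> with \<open>\<mu> = lam1 / lam2\<close> into the trace \<open>V = - tanh (\<kappa>2 * b) / \<kappa>2 * \<mu> * D\<close>. The relaxed update then has the symbol \<open>rho_hat\<close>.
\<close>

lemma dnwr_step_symbol:
  fixes a b \<alpha>1 \<alpha>2 lam1 lam2 \<theta> \<Delta>t :: real
  assumes pos: "a > 0" "b > 0" "\<alpha>1 > 0" "\<alpha>2 > 0" "lam1 > 0" "lam2 > 0" "\<Delta>t > 0"
    and step: "dnwr_error_step a b \<alpha>1 \<alpha>2 lam1 lam2 \<theta> \<Delta>t N g h"
  shows "(\<lambda>z. poly (gen_poly N h) z - rho_hat a b \<alpha>1 \<alpha>2 lam1 lam2 \<theta> ((1 - z) / of_real \<Delta>t) * poly (gen_poly N g) z)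
    \<in> O[at 0](\<lambda>z. z ^ Suc N)"
proof -
  from step[unfolded dnwr_error_step_def] obtain u1 u1' u2 u2' :: "nat \<Rightarrow> real \<Rightarrow> real" where
    u10: "\<forall>x\<in>{-a..0}. u1 0 x = 0" and u20: "\<forall>x\<in>{0..b}. u2 0 x = 0" and
    s1: "\<And>n. n < N \<Longrightarrow> heat_euler_step \<alpha>1 lam1 \<Delta>t (-a) 0 (u1 n) (u1 (Suc n)) (u1' (Suc n))" and
    bc1: "\<And>n. n < N \<Longrightarrow> u1 (Suc n) (-a) = 0" "\<And>n. n < N \<Longrightarrow> u1 (Suc n) 0 = g (Suc n)" and
    s2: "\<And>n. n < N \<Longrightarrow> heat_euler_step \<alpha>2 lam2 \<Delta>t 0 b (u2 n) (u2 (Suc n)) (u2' (Suc n))" and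
    bc2: "\<And>n. n < N \<Longrightarrow> - lam2 * u2' (Suc n) 0 = - lam1 * u1' (Suc n) 0" "\<And>n. n < N \<Longrightarrow> u2 (Suc n) b = 0" and
    h: "\<And>n. n < N \<Longrightarrow> h (Suc n) = (1 - \<theta>) * g (Suc n) + \<theta> * u2 (Suc n) 0"
    by blast
  let ?s = "\<lambda>z. (1 - z) / complex_of_real \<Delta>t"
  define \<kappa>1 where "\<kappa>1 = (\<lambda>z. wave_number \<alpha>1 lam1 (?s z))"
  define \<kappa>2 where "\<kappa>2 = (\<lambda>z. wave_number \<alpha>2 lam2 (?s z))"
  define G where "G = poly (gen_poly N g)"
  define D where "D = poly (gen_poly N (\<lambda>n. u1' n 0))"
  define V where "V = poly (gen_poly N (\<lambda>n. u2 n 0))"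
  define \<mu> where "\<mu> = complex_of_real (lam1 / lam2)"
  have u1a: "gen_poly N (\<lambda>n. u1 n (-a)) = 0" and u2b: "gen_poly N (\<lambda>n. u2 n b) = 0"
    using bc1(1) bc2(2) by (simp_all add: gen_poly_def)
  have u1z: "gen_poly N (\<lambda>n. u1 n 0) = gen_poly N g"
    using bc1(2) by (intro gen_poly_cong)
  have D2: "poly (gen_poly N (\<lambda>n. u2' n 0)) z = \<mu> * D z" for z
  proof -
    have "gen_poly N (\<lambda>n. u2' n 0) = gen_poly N (\<lambda>n. lam1 / lam2 * u1' n 0 + 0 * 0)"
      using bc2(1) pos by (intro gen_poly_cong) (simp add: field_simps)
    then show ?thesis
      using poly_gen_poly_linear[of N "lam1 / lam2" "\<lambda>n. u1' n 0" 0 "\<lambda>_. 0" z]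
      by (simp add: D_def \<mu>_def)
  qed
  have H: "poly (gen_poly N h) z = (1 - of_real \<theta>) * G z + of_real \<theta> * V z" for z
  proof -
    have "gen_poly N h = gen_poly N (\<lambda>n. (1 - \<theta>) * g n + \<theta> * u2 n 0)"
      using h by (intro gen_poly_cong)
    then show ?thesis by (simp add: poly_gen_poly_linear G_def V_def)
  qed
  \<comment> \<open>the defects in the two boundary relations, each cleared of its denominators\<close>
  define W1 where "W1 = (\<lambda>z. D z * sinh (\<kappa>1 z * of_real a) - G z * (\<kappa>1 z * cosh (\<kappa>1 z * of_real a)))"
  define W2 where "W2 = (\<lambda>z. \<mu> * D z * sinh (\<kappa>2 z * of_real b) + V z * (\<kappa>2 z * cosh (\<kappa>2 z * of_real b)))"
  have near: "eventually (\<lambda>z. cmod z < 1) (at (0::complex))"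
    by (auto simp: eventually_at intro!: exI[of _ 1])
  have W1: "W1 \<in> O[at 0](\<lambda>z. z ^ Suc N)"
  proof -
    have "-a < 0" "-a \<in> {-a..0}" using pos by auto
    from heat_transform_boundary_bound[OF pos(3,5,7) this u10 s1] obtain C where
      C: "\<And>z \<kappa> U U' W. cmod z < 1 \<Longrightarrow>
        \<kappa> = csqrt (of_real \<alpha>1 * ((1 - z) / of_real \<Delta>t) / of_real lam1) \<Longrightarrow>
        U = (\<lambda>x. poly (gen_poly N (\<lambda>n. u1 n x)) z) \<Longrightarrow>
        U' = (\<lambda>x. poly (gen_poly N (\<lambda>n. u1' n x)) z) \<Longrightarrow>
        W = (\<lambda>x. U' x * sinh (\<kappa> * of_real (x - (-a))) - U x * (\<kappa> * cosh (\<kappa> * of_real (x - (-a))))) \<Longrightarrow>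
        cmod (W 0 - W (-a)) \<le> C * cmod z ^ Suc N"
      by metis
    have "cmod (W1 z) \<le> C * cmod (z ^ Suc N)" if "cmod z < 1" for z
      using C[OF that refl refl refl refl]
      by (simp add: W1_def D_def G_def \<kappa>1_def wave_number_def u1a u1z norm_mult norm_power)
    with near show ?thesis
      by (intro bigoI[of _ C]) (auto elim!: eventually_mono)
  qed
  have W2: "W2 \<in> O[at 0](\<lambda>z. z ^ Suc N)"
  proof -
    have "b \<in> {0..b}" using pos by auto
    from heat_transform_boundary_bound[OF pos(4,6,7,2) this u20 s2] obtain C where
      C: "\<And>z \<kappa> U U' W. cmod z < 1 \<Longrightarrow>
        \<kappa> = csqrt (of_real \<alpha>2 * ((1 - z) / of_real \<Delta>t) / of_real lam2) \<Longrightarrow>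
        U = (\<lambda>x. poly (gen_poly N (\<lambda>n. u2 n x)) z) \<Longrightarrow>
        U' = (\<lambda>x. poly (gen_poly N (\<lambda>n. u2' n x)) z) \<Longrightarrow>
        W = (\<lambda>x. U' x * sinh (\<kappa> * of_real (x - b)) - U x * (\<kappa> * cosh (\<kappa> * of_real (x - b)))) \<Longrightarrow>
        cmod (W b - W 0) \<le> C * cmod z ^ Suc N"
      by metis
    have "cmod (W2 z) \<le> C * cmod (z ^ Suc N)" if "cmod z < 1" for z
      using C[OF that refl refl refl refl]
      by (simp add: W2_def V_def \<kappa>2_def wave_number_def u2b D2 norm_mult norm_power algebra_simps)
    with near show ?thesis
      by (intro bigoI[of _ C]) (auto elim!: eventually_mono)
  qed
  \<comment> \<open>the factors with which the defects enter when the relations are solved for \<open>V\<close>; both are holomorphic,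
    hence bounded, near the origin\<close>
  define A where "A = (\<lambda>z. 1 / (\<kappa>2 z * cosh (\<kappa>2 z * of_real b)))"
  define B where "B = (\<lambda>z. sinh (\<kappa>2 z * of_real b) / (sinh (\<kappa>1 z * of_real a) * \<kappa>2 z * cosh (\<kappa>2 z * of_real b)))"
  have Re_s: "Re (?s z) > 0" if "cmod z < 1" for z
    using Re_one_minus_pos[OF pos(7) that] .
  have nz: "sinh (\<kappa>1 z * of_real a) \<noteq> 0" "cosh (\<kappa>2 z * of_real b) \<noteq> 0" "\<kappa>2 z \<noteq> 0" if "cmod z < 1" for z
    unfolding \<kappa>1_def \<kappa>2_def
    by (intro wave_number_cosh_sinh_nonzero wave_number_nonzero pos Re_s that)+
  have "\<kappa>1 holomorphic_on ball 0 1" "\<kappa>2 holomorphic_on ball 0 1"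
    unfolding \<kappa>1_def \<kappa>2_def
    using pos Re_s by (auto intro!: holomorphic_on_wave_number holomorphic_intros)
  then have "A holomorphic_on ball 0 1" "B holomorphic_on ball 0 1"
    unfolding A_def B_def using nz by (auto intro!: holomorphic_intros holomorphic_on_sinh_cosh)
  then have "isCont A 0" "isCont B 0"
    by (auto dest!: holomorphic_on_imp_continuous_on simp: continuous_on_eq_continuous_at)
  then have "A \<in> O[at 0](\<lambda>_. 1)" "B \<in> O[at 0](\<lambda>_. 1)"
    by (auto intro: continuous_imp_bigo_1)
  from landau_o.big.mult[OF W2 this(1)] landau_o.big.mult[OF W1 this(2)]
  have "(\<lambda>z. of_real \<theta> * (W2 z * A z)) \<in> O[at 0](\<lambda>z. z ^ Suc N)"
    "(\<lambda>z. of_real \<theta> * \<mu> * (W1 z * B z)) \<in> O[at 0](\<lambda>z. z ^ Suc N)"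
    by (auto intro!: landau_o.big.cmult_in_iff')
  from sum_in_bigo(2)[OF this]
  have "(\<lambda>z. of_real \<theta> * (W2 z * A z) - of_real \<theta> * \<mu> * (W1 z * B z)) \<in> O[at 0](\<lambda>z. z ^ Suc N)" .
  moreover have "of_real \<theta> * (W2 z * A z) - of_real \<theta> * \<mu> * (W1 z * B z)
      = poly (gen_poly N h) z - rho_hat a b \<alpha>1 \<alpha>2 lam1 lam2 \<theta> (?s z) * poly (gen_poly N g) z"
    if z: "cmod z < 1" for z
  proof -
    define X where "X = \<mu> * \<kappa>1 z / \<kappa>2 z * (cosh (\<kappa>1 z * of_real a) / sinh (\<kappa>1 z * of_real a)) *
        (sinh (\<kappa>2 z * of_real b) / cosh (\<kappa>2 z * of_real b))"
    have residual: "W2 z * A z - \<mu> * (W1 z * B z) = V z + X * G z"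
      using nz[OF z] by (simp add: W1_def W2_def A_def B_def X_def field_simps)
    have R: "rho_hat a b \<alpha>1 \<alpha>2 lam1 lam2 \<theta> (?s z) = 1 - of_real \<theta> - of_real \<theta> * X"
      using rho_hat_eq_wave_number_ratio[OF pos(3-6) Re_s[OF z]]
      by (simp add: \<kappa>1_def \<kappa>2_def \<mu>_def X_def)
    have "poly (gen_poly N h) z - rho_hat a b \<alpha>1 \<alpha>2 lam1 lam2 \<theta> (?s z) * poly (gen_poly N g) z
        = of_real \<theta> * (V z + X * G z)"
      unfolding H R by (simp add: G_def algebra_simps)
    also have "\<dots> = of_real \<theta> * (W2 z * A z - \<mu> * (W1 z * B z))"
      unfolding residual ..
    finally have "poly (gen_poly N h) z - rho_hat a b \<alpha>1 \<alpha>2 lam1 lam2 \<theta> (?s z) * poly (gen_poly N g) z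
        = of_real \<theta> * (W2 z * A z - \<mu> * (W1 z * B z))" .
    then show ?thesis by (simp add: algebra_simps)
  qed
  ultimately show ?thesis
    using near by (subst landau_o.big.in_cong[symmetric]) (auto elim: eventually_mono)
qed

lemma dnwr_iterates_symbol:
  fixes a b \<alpha>1 \<alpha>2 lam1 lam2 \<theta> \<Delta>t :: real
  assumes pos: "a > 0" "b > 0" "\<alpha>1 > 0" "\<alpha>2 > 0" "lam1 > 0" "lam2 > 0" "\<Delta>t > 0"
    and step: "\<And>j. dnwr_error_step a b \<alpha>1 \<alpha>2 lam1 lam2 \<theta> \<Delta>t N (h j) (h (Suc j))"
  defines "R \<equiv> \<lambda>z. rho_hat a b \<alpha>1 \<alpha>2 lam1 lam2 \<theta> ((1 - z) / of_real \<Delta>t)"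
  shows "(\<lambda>z. poly (gen_poly N (h k)) z - R z ^ k * poly (gen_poly N (h 0)) z) \<in> O[at 0](\<lambda>z. z ^ Suc N)"
proof (induction k)
  case (Suc k)
  have "R holomorphic_on ball 0 1"
    unfolding R_def using pos Re_one_minus_pos[OF pos(7)]
    by (intro holomorphic_on_rho_hat) (auto intro!: holomorphic_intros)
  then have "isCont R 0"
    by (auto dest!: holomorphic_on_imp_continuous_on simp: continuous_on_eq_continuous_at)
  then have "R \<in> O[at 0](\<lambda>_. 1)"
    by (rule continuous_imp_bigo_1)
  from landau_o.big.mult[OF this Suc.IH]
  have "(\<lambda>z. R z * (poly (gen_poly N (h k)) z - R z ^ k * poly (gen_poly N (h 0)) z)) \<in> O[at 0](\<lambda>z. z ^ Suc N)"
    by simp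
  from sum_in_bigo(1)[OF dnwr_step_symbol[OF pos step[of k]] this]
  show ?case by (simp add: R_def algebra_simps)
qed simp

section \<open>The error bound\<close>

theorem theorem4:
  fixes a b T \<alpha>1 \<alpha>2 lam1 lam2 \<theta> \<Delta>t :: real
    and N k :: nat
    and h :: "nat \<Rightarrow> nat \<Rightarrow> real"
  assumes "a > 0" "b > 0" "T > 0"
    and "\<alpha>1 > 0" "\<alpha>2 > 0" "lam1 > 0" "lam2 > 0"
    and "N \<ge> 1" and "\<Delta>t = T / real N"
    and "0 < \<theta>" "\<theta> < 1"
    and "\<And>j. dnwr_error_step a b \<alpha>1 \<alpha>2 lam1 lam2 \<theta> \<Delta>t N (h j) (h (Suc j))"
    and "k \<ge> 1"
  shows "L2_set (h k) {1..N} \<le>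
    (INF r\<in>{0<..}. exp (r * T) *
       (SUP \<omega>\<in>{-pi..pi}. cmod (rho_hat a b \<alpha>1 \<alpha>2 lam1 lam2 \<theta> (euler_symbol \<Delta>t r \<omega>) ^ k))) *
    L2_set (h 0) {1..N}"
proof -
  have \<Delta>t: "\<Delta>t > 0" using assms by simp
  note pos = assms(1,2,4-7) \<Delta>t
  define R where "R = (\<lambda>z. rho_hat a b \<alpha>1 \<alpha>2 lam1 lam2 \<theta> ((1 - z) / of_real \<Delta>t))"
  define S where "S = (\<lambda>r. SUP \<omega>\<in>{-pi..pi}. cmod (rho_hat a b \<alpha>1 \<alpha>2 lam1 lam2 \<theta> (euler_symbol \<Delta>t r \<omega>) ^ k))"
  have R: "R holomorphic_on ball 0 1"
    unfolding R_def using pos Re_one_minus_pos[OF \<Delta>t]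
    by (intro holomorphic_on_rho_hat) (auto intro!: holomorphic_intros)
  have weighted: "(\<Sum>n\<le>N. (cmod (coeff (gen_poly N v) n) * q ^ n)\<^sup>2) = (\<Sum>n=1..N. (v n * q ^ n)\<^sup>2)" for v q
    by (rule sum.mono_neutral_cong_right) (auto simp: coeff_gen_poly power_mult_distrib)
  have main: "L2_set (h k) {1..N} \<le> exp (r * T) * S r * L2_set (h 0) {1..N}" if r: "r > 0" for r
  proof -
    define q where "q = exp (- (r * \<Delta>t))"
    have q: "0 < q" "q < 1" using r \<Delta>t by (auto simp: q_def)
    have circle: "cmod (R z ^ k) \<le> S r" if "cmod z = q" for z
    proof -
      obtain \<omega>0 where \<omega>0: "\<omega>0 \<in> {-pi..pi}"
        "\<And>w. w \<in> {-pi..pi} \<Longrightarrow> cmod (rho_hat a b \<alpha>1 \<alpha>2 lam1 lam2 \<theta> (euler_symbol \<Delta>t r w) ^ k) \<le>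
          cmod (rho_hat a b \<alpha>1 \<alpha>2 lam1 lam2 \<theta> (euler_symbol \<Delta>t r \<omega>0) ^ k)"
        "S r = cmod (rho_hat a b \<alpha>1 \<alpha>2 lam1 lam2 \<theta> (euler_symbol \<Delta>t r \<omega>0) ^ k)"
        unfolding S_def using rho_hat_SUP_attained[OF pos r, of \<theta> k] by metis
      \<comment> \<open>every point of the circle corresponds to the frequency \<open>- Arg z\<close>\<close>
      have "z = exp (- of_real (r * \<Delta>t) - \<i> * of_real (- Arg z))"
        using rcis_cmod_Arg[of z] that
        by (simp add: rcis_def q_def cis_conv_exp exp_add exp_diff exp_minus divide_inverse mult.commute flip: exp_of_real)
      then have "R z = rho_hat a b \<alpha>1 \<alpha>2 lam1 lam2 \<theta> (euler_symbol \<Delta>t r (- Arg z))"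
        unfolding R_def euler_symbol_def by metis
      then show ?thesis
        using \<omega>0 Arg_bounded[of z] by simp
    qed
    have "cmod (R (of_real q) ^ k) \<le> S r"
      using q by (intro circle) simp
    then have S0: "0 \<le> S r"
      by (rule order_trans[OF norm_ge_zero])
    have "(\<Sum>n=1..N. (h k n * q ^ n)\<^sup>2) \<le> (S r)\<^sup>2 * (\<Sum>n=1..N. (h 0 n * q ^ n)\<^sup>2)"
      unfolding weighted[symmetric]
    proof (rule l2_bound_of_truncated_multiplier[OF _ q])
      show "(\<lambda>z. R z ^ k) holomorphic_on ball 0 1"
        by (intro holomorphic_intros R)
      show "degree (gen_poly N (h 0)) \<le> N"
        by (rule degree_le) (simp add: coeff_gen_poly)
      show "(\<lambda>z. poly (gen_poly N (h k)) z - R z ^ k * poly (gen_poly N (h 0)) z) \<in> O[at 0](\<lambda>z. z ^ Suc N)"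
        unfolding R_def by (rule dnwr_iterates_symbol[where h = h, OF pos assms(12)])
    qed (use circle in auto)
    also have "\<dots> \<le> (S r)\<^sup>2 * (\<Sum>n=1..N. (h 0 n)\<^sup>2)"
      using q by (intro mult_left_mono sum_mono)
        (auto simp: power_mult_distrib power_le_one intro!: mult_right_le_one_le)
    finally have *: "(\<Sum>n=1..N. (h k n * q ^ n)\<^sup>2) \<le> (S r)\<^sup>2 * (\<Sum>n=1..N. (h 0 n)\<^sup>2)" .
    have "(q ^ N)\<^sup>2 * (\<Sum>n=1..N. (h k n)\<^sup>2) \<le> (\<Sum>n=1..N. (h k n * q ^ n)\<^sup>2)"
      unfolding sum_distrib_left
    proof (intro sum_mono)
      fix n assume "n \<in> {1..N}"
      then have "q ^ N \<le> q ^ n" using q by (intro power_decreasing) auto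
      then have "(q ^ N)\<^sup>2 \<le> (q ^ n)\<^sup>2" using q by (intro power_mono) auto
      then show "(q ^ N)\<^sup>2 * (h k n)\<^sup>2 \<le> (h k n * q ^ n)\<^sup>2"
        by (simp add: power_mult_distrib mult.commute[of "(h k n)\<^sup>2"] mult_right_mono)
    qed
    with * have "sqrt ((q ^ N)\<^sup>2 * (\<Sum>n=1..N. (h k n)\<^sup>2)) \<le> sqrt ((S r)\<^sup>2 * (\<Sum>n=1..N. (h 0 n)\<^sup>2))"
      by (intro real_sqrt_le_mono) linarith
    then have "q ^ N * L2_set (h k) {1..N} \<le> S r * L2_set (h 0) {1..N}"
      using q S0 by (simp add: real_sqrt_mult L2_set_def)
    moreover have "q ^ N = exp (- (r * T))"
      using assms(8,9) by (simp add: q_def flip: exp_of_nat_mult)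
    ultimately show ?thesis
      by (simp add: exp_minus field_simps)
  qed
  \<comment> \<open>division by the initial norm moves the bound into the infimum\<close>
  show ?thesis
  proof (cases "L2_set (h 0) {1..N} = 0")
    case True
    then show ?thesis using main[of 1] by simp
  next
    case False
    then have L: "L2_set (h 0) {1..N} > 0"
      using L2_set_nonneg[of "h 0" "{1..N}"] by linarith
    have "L2_set (h k) {1..N} / L2_set (h 0) {1..N} \<le> (INF r\<in>{0<..}. exp (r * T) * S r)"
      using main L by (intro cINF_greatest) (auto simp: field_simps)
    then show ?thesis
      using L by (simp add: S_def field_simps)
  qed
qed

end
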